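(* Let $T\in\mathbb{F}^{n_1}\otimes\mathbb{F}^{n_2}\otimes\mathbb{F}^{n_3}$ be concise. For every choice of distinct $i,j,k\in[3]$ we have $\rho_{i,j}(T)\cdot\max\{Q_i(T),Q_j(T)\}\geq n_k$.
   Context: For a nonzero matrix $A\in\mathbb{F}^{m_1\times m_2}$, its pivot $p(A)$ is the lexicographically smallest $(a,b)$ with $A_{a,b}\neq 0$. Every subspace $\mathcal{A}$ of $m_1\times m_2$ matrices has a basis whose elements have pairwise distinct pivots, and the set of these pivots is the same for every such basis; it is denoted $p(\mathcal{A})$. $\rho(\mathcal{A})$ is the smallest $|S_1|+|S_2|$ over $S_1\subseteq[m_1]$, $S_2\subseteq[m_2]$ with $p(\mathcal{A})\subseteq(S_1\times[m_2])\cup([m_1]\times S_2)$. For $T=\sum T_{a_1,a_2,a_3}e_{a_1}\otimes e_{a_2}\otimes e_{a_3}$ and distinct $i,j\in[3]$ with $\ell$ the third index, $\mathcal{A}_{i,j}\subseteq\mathbb{F}^{n_i}\otimes\mathbb{F}^{n_j}$ is the span, over $t\in[n_\ell]$, of the matrices whose $(a,b)$ entry ($a\in[n_i]$ indexing rows, $b\in[n_j]$ indexing columns) is the coefficient of $T$ with $a_i=a$, $a_j=b$, $a_\ell=t$; and $\rho_{i,j}(T)=\rho(\mathcal{A}_{i,j})$. For $\ell\in[3]$, $Q_\ell(T)$ is the maximum rank of an element of the span of the $\ell$-slices of $T$ (the matrices obtained by fixing the $\ell$-th index). $T$ is concise if each flattening $\mathbb{F}^{n_i}\otimes(\mathbb{F}^{n_j}\otimes\mathbb{F}^{n_k})$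 has rank $n_i$. *)

theory Defs
  imports "Jordan_Normal_Form.DL_Rank"
begin

text \<open>
  The pivot of a nonzero matrix. Rows and columns are numbered from \<open>0\<close>, as in
  \<^theory>\<open>Jordan_Normal_Form.Matrix\<close>. The order is the lexicographic one, comparing row
  indices first; the value is unspecified on zero matrices.
\<close>

definition nonzero_entries :: "'a::zero mat \<Rightarrow> (nat \<times> nat) set" where
  "nonzero_entries A = {(a, b). a < dim_row A \<and> b < dim_col A \<and> A $$ (a, b) \<noteq> 0}"

definition pivot :: "'a::zero mat \<Rightarrow> nat \<times> nat" where
  "pivot A = (THE p. p \<in> nonzero_entries A \<and>
     (\<forall>q \<in> nonzero_entries A. q \<noteq> p \<longrightarrow> (p, q) \<in> less_than <*lex*> less_than))"

text \<open>
  The pivot set of a subspace \<open>\<A>\<close> of the \<open>m\<^sub>1 \<times> m\<^sub>2\<close> matrices: the common set of pivots of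
  all bases of \<open>\<A>\<close> whose elements have pairwise distinct pivots.
\<close>

definition pivot_basis :: "nat \<Rightarrow> nat \<Rightarrow> 'a::field mat set \<Rightarrow> 'a mat set \<Rightarrow> bool" where
  "pivot_basis m\<^sub>1 m\<^sub>2 \<A> B \<longleftrightarrow>
     vectorspace.basis class_ring ((module_mat TYPE('a) m\<^sub>1 m\<^sub>2)\<lparr>carrier := \<A>\<rparr>) B \<and>
     inj_on pivot B"

definition pivot_set :: "nat \<Rightarrow> nat \<Rightarrow> 'a::field mat set \<Rightarrow> (nat \<times> nat) set" where
  "pivot_set m\<^sub>1 m\<^sub>2 \<A> = (THE P. \<exists>B. pivot_basis m\<^sub>1 m\<^sub>2 \<A> B \<and> P = pivot ` B)"

definition rho :: "nat \<Rightarrow> nat \<Rightarrow> 'a::field mat set \<Rightarrow> nat" where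
  "rho m\<^sub>1 m\<^sub>2 \<A> = (LEAST r. \<exists>S\<^sub>1 S\<^sub>2. S\<^sub>1 \<subseteq> {..<m\<^sub>1} \<and> S\<^sub>2 \<subseteq> {..<m\<^sub>2} \<and>
     pivot_set m\<^sub>1 m\<^sub>2 \<A> \<subseteq> (S\<^sub>1 \<times> {..<m\<^sub>2}) \<union> ({..<m\<^sub>1} \<times> S\<^sub>2) \<and> r = card S\<^sub>1 + card S\<^sub>2)"

text \<open>
  A tensor in \<open>\<bbbF>\<^bsup>n 1\<^esup> \<otimes> \<bbbF>\<^bsup>n 2\<^esup> \<otimes> \<bbbF>\<^bsup>n 3\<^esup>\<close> is given by the dimension
  function \<open>n\<close> and its coefficients \<open>T a\<^sub>1 a\<^sub>2 a\<^sub>3\<close> for \<open>a\<^sub>s < n s\<close>; no definition below looks at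
  \<open>T\<close> outside this range. The three tensor legs are numbered \<open>1, 2, 3\<close>.
\<close>

type_synonym 'a tensor3 = "nat \<Rightarrow> nat \<Rightarrow> nat \<Rightarrow> 'a"

text \<open>The coefficient of \<open>T\<close> whose index is \<open>a\<close> on leg \<open>i\<close>, \<open>b\<close> on leg \<open>j\<close>, and \<open>t\<close> on the
  remaining leg.\<close>

definition coeff_at :: "'a tensor3 \<Rightarrow> nat \<Rightarrow> nat \<Rightarrow> nat \<Rightarrow> nat \<Rightarrow> nat \<Rightarrow> 'a" where
  "coeff_at T i j a b t =
     (let x = (\<lambda>s. if s = i then a else if s = j then b else t) in T (x 1) (x 2) (x 3))"

definition third_leg :: "nat \<Rightarrow> nat \<Rightarrow> nat" where
  "third_leg i j = (THE l. l \<in> {1, 2, 3} - {i, j})"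

definition slice :: "(nat \<Rightarrow> nat) \<Rightarrow> 'a tensor3 \<Rightarrow> nat \<Rightarrow> nat \<Rightarrow> nat \<Rightarrow> 'a mat" where
  "slice n T i j t = mat (n i) (n j) (\<lambda>(a, b). coeff_at T i j a b t)"

text \<open>\<open>\<A>\<^bsub>i,j\<^esub>\<close>\<close>

definition slice_space :: "(nat \<Rightarrow> nat) \<Rightarrow> 'a::field tensor3 \<Rightarrow> nat \<Rightarrow> nat \<Rightarrow> 'a mat set" where
  "slice_space n T i j = LinearCombinations.module.span class_ring (module_mat TYPE('a) (n i) (n j))
     {slice n T i j t | t. t < n (third_leg i j)}"

definition tensor_rho :: "(nat \<Rightarrow> nat) \<Rightarrow> 'a::field tensor3 \<Rightarrow> nat \<Rightarrow> nat \<Rightarrow> nat" where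
  "tensor_rho n T i j = rho (n i) (n j) (slice_space n T i j)"

text \<open>The two legs other than \<open>l\<close>, in increasing order.\<close>

definition other_legs :: "nat \<Rightarrow> nat \<times> nat" where
  "other_legs l = (if l = 1 then (2, 3) else if l = 2 then (1, 3) else (1, 2))"

text \<open>
  \<open>Q\<^sub>l(T)\<close>. The \<open>l\<close>-slices are written with the smaller remaining leg as rows; the opposite
  choice transposes all of them, which changes no rank.
\<close>

definition max_slice_rank :: "(nat \<Rightarrow> nat) \<Rightarrow> 'a::field tensor3 \<Rightarrow> nat \<Rightarrow> nat" where
  "max_slice_rank n T l =
     (case other_legs l of (i, j) \<Rightarrow> Max (vec_space.rank (n i) ` slice_space n T i j))"

text \<open>
  The flattening along leg \<open>i\<close> as an \<open>n i \<times> (n j * n k)\<close> matrix, where \<open>j < k\<close> are the other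
  legs and column \<open>b * n k + c\<close> stands for the index pair \<open>(b, c)\<close>.
\<close>

definition flattening :: "(nat \<Rightarrow> nat) \<Rightarrow> 'a tensor3 \<Rightarrow> nat \<Rightarrow> 'a mat" where
  "flattening n T i = (case other_legs i of (j, k) \<Rightarrow>
     mat (n i) (n j * n k) (\<lambda>(a, col). coeff_at T i j a (col div n k) (col mod n k)))"

definition concise :: "(nat \<Rightarrow> nat) \<Rightarrow> 'a::field tensor3 \<Rightarrow> bool" where
  "concise n T \<longleftrightarrow> (\<forall>i \<in> {1, 2, 3}. vec_space.rank (n i) (flattening n T i) = n i)"

end

theory Submission
  imports Defs
begin

text \<open>The pivot set of a subspace consists of the pivots of its nonzero elements. For the space
  spanned by the slices it has at least \<open>n k\<close> elements: imposing zeros at all its positions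
  leaves only the zero matrix, and by conciseness the slices are linearly independent. If matrices
  of this space have their pivots in distinct columns of a common row \<open>a\<close>, their rows \<open>a\<close> are
  in echelon form, and these rows lie in the image of the slice of leg \<open>i\<close> at \<open>a\<close>; hence row
  \<open>a\<close> contains at most \<open>Q\<^sub>i(T)\<close> pivots. In the same way a column contains at most
  \<open>Q\<^sub>j(T)\<close> pivots. Summing over a minimal cover by rows and columns gives the bound.\<close>

section \<open>Linear algebra: triangular systems, rank and left kernels\<close>

text \<open>In a vanishing combination let \<open>S'\<close> be the support of the coefficients: the
  functional that \<open>tri\<close> supplies for \<open>S'\<close> keeps exactly one term, which
  therefore cannot have a nonzero coefficient. Quantifying over subsets instead of fixing an order
  lets the lemma serve minima, maxima and the lexicographic order alike.\<close>

lemma lin_indpt_if_triangular: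
  fixes M :: "('a::field, 'v, 'm) module_scheme" and \<phi> :: "'i \<Rightarrow> 'v \<Rightarrow> 'a"
  assumes M: "Module.module class_ring M" and S: "finite S" and v: "v ` S \<subseteq> carrier M"
    and add: "\<And>s x y. s \<in> S \<Longrightarrow> x \<in> carrier M \<Longrightarrow> y \<in> carrier M \<Longrightarrow> \<phi> s (x \<oplus>\<^bsub>M\<^esub> y) = \<phi> s x + \<phi> s y"
    and smult: "\<And>s c x. s \<in> S \<Longrightarrow> x \<in> carrier M \<Longrightarrow> \<phi> s (c \<odot>\<^bsub>M\<^esub> x) = c * \<phi> s x"
    and tri: "\<And>S'. S' \<subseteq> S \<Longrightarrow> S' \<noteq> {} \<Longrightarrow> \<exists>s\<in>S'. \<phi> s (v s) \<noteq> 0 \<and> (\<forall>s'\<in>S' - {s}. \<phi> s (v s') = 0)"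
  shows "inj_on v S" and "\<not> LinearCombinations.module.lin_dep class_ring M (v ` S)"
proof -
  interpret Module.module class_ring M by (rule M)
  show inj: "inj_on v S"
  proof (rule inj_onI, rule ccontr)
    fix s s' assume "s \<in> S" "s' \<in> S" "v s = v s'" "s \<noteq> s'"
    \<comment> \<open>On the pair \<open>{s, s'}\<close> the functional from \<open>tri\<close> is
      nonzero at one vector and zero at the other, although the two vectors coincide.\<close>
    then show False using tri[of "{s, s'}"] by (auto simp: insert_Diff_if)
  qed
  have zero: "\<phi> s \<zero>\<^bsub>M\<^esub> = 0" if "s \<in> S" for s
    using smult[OF that, of "\<zero>\<^bsub>M\<^esub>" 0] by simp
  have \<phi>_lincomb: "\<phi> s (lincomb a A) = (\<Sum>x\<in>A. a x * \<phi> s x)"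
    if "s \<in> S" "finite A" "A \<subseteq> carrier M" for s a A
    using that(2,3)
  proof (induction A rule: finite_induct)
    case empty
    then show ?case using zero[OF that(1)] by (simp add: lincomb_def)
  next
    case (insert x A)
    have "lincomb a (insert x A) = a x \<odot>\<^bsub>M\<^esub> x \<oplus>\<^bsub>M\<^esub> lincomb a A"
      using insert unfolding lincomb_def by (subst finsum_insert) auto
    moreover have "lincomb a A \<in> carrier M"
      using insert by (intro lincomb_closed) auto
    ultimately show ?case using insert add[OF that(1)] smult[OF that(1)] by auto
  qed
  show "\<not> lin_dep (v ` S)"
  proof
    assume "lin_dep (v ` S)"
    then obtain a x where a: "lincomb a (v ` S) = \<zero>\<^bsub>M\<^esub>" "x \<in> v ` S" "a x \<noteq> 0"
      using finite_lin_dep[OF _ _ v] S by auto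
    define S' where "S' = {s \<in> S. a (v s) \<noteq> 0}"
    have "S' \<subseteq> S" "S' \<noteq> {}" using a(2,3) by (auto simp: S'_def)
    from tri[OF this] obtain s where s: "s \<in> S'" "\<phi> s (v s) \<noteq> 0"
      and off: "\<forall>s'\<in>S' - {s}. \<phi> s (v s') = 0" by blast
    have sS: "s \<in> S" using s by (simp add: S'_def)
    have "0 = \<phi> s (lincomb a (v ` S))" using a(1) zero[OF sS] by simp
    also have "\<dots> = (\<Sum>t\<in>S. a (v t) * \<phi> s (v t))"
      using \<phi>_lincomb[OF sS _ v] S by (simp add: sum.reindex[OF inj])
    also have "\<dots> = (\<Sum>t\<in>{s}. a (v t) * \<phi> s (v t))"
      using S off sS by (intro sum.mono_neutral_right) (auto simp: S'_def)
    finally show False using s by (auto simp: S'_def)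
  qed
qed

text \<open>\<open>rank\<close> is the dimension of the column space regarded as a vector space of
  its own, so the independence of \<open>W\<close> is first transferred to that space.\<close>

lemma (in vec_space) card_le_rank:
  assumes A: "A \<in> carrier_mat n nc" and W: "W \<subseteq> span (set (cols A))" "lin_indpt W"
  shows "card W \<le> rank A"
proof -
  have sub: "set (cols A) \<subseteq> carrier V" using A cols_dim[of A] by auto
  have submod: "submodule class_ring (span (set (cols A))) V"
    using span_is_submodule sub by simp
  have "vectorspace class_ring (span_vs (set (cols A)))"
    using sub span_is_subspace subspace_def subspace_is_vs by simp
  then interpret C: vectorspace class_ring "span_vs (set (cols A))" .
  have "C.lin_indpt W"
    using span_li_not_depend(2)[OF W(1) submod] W(2) by simp
  then show ?thesis
    unfolding rank_def using C.li_le_dim(2)[OF fin_dim_span_cols[OF A]] W(1) by auto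
qed

lemma (in vec_space) mult_mat_vec_in_span_cols:
  assumes "A \<in> carrier_mat n nc" "w \<in> carrier_vec nc"
  shows "A *\<^sub>v w \<in> span (set (cols A))"
  using col_space_eq[OF assms(1)] assms unfolding col_space_def by auto

lemma card_le_rank_if_triangular:
  fixes M :: "'a::field mat" and S :: "'i set"
  assumes M: "M \<in> carrier_mat nr nc" and S: "finite S"
    and u: "\<And>s. s \<in> S \<Longrightarrow> u s \<in> carrier_vec nr" and w: "\<And>s. s \<in> S \<Longrightarrow> w s \<in> carrier_vec nc"
    and tri: "\<And>S'. S' \<subseteq> S \<Longrightarrow> S' \<noteq> {} \<Longrightarrow>
      \<exists>s\<in>S'. u s \<bullet> (M *\<^sub>v w s) \<noteq> 0 \<and> (\<forall>s'\<in>S' - {s}. u s \<bullet> (M *\<^sub>v w s') = 0)"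
  shows "card S \<le> vec_space.rank nr M"
proof -
  interpret vec_space "TYPE('a)" nr .
  define v where "v = (\<lambda>s. M *\<^sub>v w s)"
  have v: "v ` S \<subseteq> carrier V" using M w by (auto simp: v_def)
  note L = lin_indpt_if_triangular[where v = v and \<phi> = "\<lambda>s x. u s \<bullet> x" and S = S and M = V,
      OF vec_module S v]
  have tri_v: "\<And>S'. S' \<subseteq> S \<Longrightarrow> S' \<noteq> {} \<Longrightarrow>
      \<exists>s\<in>S'. u s \<bullet> v s \<noteq> 0 \<and> (\<forall>s'\<in>S' - {s}. u s \<bullet> v s' = 0)"
    unfolding v_def by (rule tri)
  have inj: "inj_on v S" and li: "lin_indpt (v ` S)"
    by (rule L[OF _ _ tri_v]; use u in \<open>simp add: scalar_prod_add_distrib[where n = nr]\<close>)+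
  have "v ` S \<subseteq> span (set (cols M))"
    unfolding v_def by (intro image_subsetI mult_mat_vec_in_span_cols[OF M] w)
  from card_le_rank[OF M this li] show ?thesis by (simp add: card_image[OF inj])
qed

text \<open>For \<open>M\<close> the least index of a subset isolates a term. Under transposition
  \<open>u\<close> and \<open>w\<close> exchange roles and the triangular array is reflected, so the
  greatest index does. Both bounds are wanted because \<open>max_slice_rank\<close> fixes one
  orientation of each slice.\<close>

lemma card_le_rank_if_triangular_nat:
  fixes M :: "'a::field mat" and S :: "nat set"
  assumes M: "M \<in> carrier_mat nr nc" and S: "finite S"
    and u: "\<And>s. s \<in> S \<Longrightarrow> u s \<in> carrier_vec nr" and w: "\<And>s. s \<in> S \<Longrightarrow> w s \<in> carrier_vec nc"
    and diag: "\<And>s. s \<in> S \<Longrightarrow> u s \<bullet> (M *\<^sub>v w s) \<noteq> 0"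
    and low: "\<And>s s'. s \<in> S \<Longrightarrow> s' \<in> S \<Longrightarrow> s < s' \<Longrightarrow> u s \<bullet> (M *\<^sub>v w s') = 0"
  shows "card S \<le> vec_space.rank nr M" and "card S \<le> vec_space.rank nc M\<^sup>T"
proof -
  show "card S \<le> vec_space.rank nr M"
  proof (rule card_le_rank_if_triangular[OF M S u w])
    fix S' assume S': "S' \<subseteq> S" "S' \<noteq> {}"
    then have "finite S'" using S finite_subset by blast
    then show "\<exists>s\<in>S'. u s \<bullet> (M *\<^sub>v w s) \<noteq> 0 \<and> (\<forall>s'\<in>S' - {s}. u s \<bullet> (M *\<^sub>v w s') = 0)"
      using S' diag low Min_in[of S'] Min_le[of S']
      by (intro bexI[of _ "Min S'"]) (auto simp: subset_iff order.not_eq_order_implies_strict)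
  qed
  have transp: "w s \<bullet> (M\<^sup>T *\<^sub>v u s') = u s' \<bullet> (M *\<^sub>v w s)" if "s \<in> S" "s' \<in> S" for s s'
    using transpose_vec_mult_scalar[OF M w[OF that(1)] u[OF that(2)]] M u w that
    by (metis mult_mat_vec_carrier comm_scalar_prod transpose_carrier_mat)
  show "card S \<le> vec_space.rank nc M\<^sup>T"
  proof (rule card_le_rank_if_triangular[OF _ S w u])
    fix S' assume S': "S' \<subseteq> S" "S' \<noteq> {}"
    then have "finite S'" using S finite_subset by blast
    then have "Max S' \<in> S'" "\<And>s. s \<in> S' - {Max S'} \<Longrightarrow> s < Max S'"
      using S' by (auto simp: order.not_eq_order_implies_strict)
    then show "\<exists>s\<in>S'. w s \<bullet> (M\<^sup>T *\<^sub>v u s) \<noteq> 0 \<and> (\<forall>s'\<in>S' - {s}. w s \<bullet> (M\<^sup>T *\<^sub>v u s') = 0)"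
      using S' diag low by (intro bexI[of _ "Max S'"]) (auto simp: transp subset_iff)
  qed (use M in auto)
qed

text \<open>Full row rank makes each unit vector a combination \<open>F *\<^sub>v y\<close> of
  columns. Pairing it with \<open>c\<close> gives \<open>c t\<close>; moving \<open>F\<close> across
  the scalar product gives zero.\<close>

lemma full_row_rank_left_kernel:
  fixes F :: "'a::field mat"
  assumes F: "F \<in> carrier_mat n nc" and rank: "vec_space.rank n F = n"
    and c: "\<And>j. j < nc \<Longrightarrow> (\<Sum>t<n. c t * F $$ (t, j)) = 0" and t: "t < n"
  shows "c t = 0"
proof -
  interpret vec_space "TYPE('a)" n .
  have sub: "set (cols F) \<subseteq> carrier V" using F cols_dim[of F] by auto
  \<comment> \<open>The rank is the size of a maximal independent set of columns; having
    \<open>n\<close> elements, this set is a basis of the whole space.\<close>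
  obtain U where U: "finite U" "maximal U (\<lambda>T. T \<subseteq> set (cols F) \<and> lin_indpt T)"
    using maximal_exists_superset[of "set (cols F)" "\<lambda>T. T \<subseteq> set (cols F) \<and> lin_indpt T" "{}"]
    by (auto simp: lin_dep_def)
  have "card U = n" using rank_card_indpt[OF F U(2)] rank by simp
  moreover have U': "U \<subseteq> set (cols F)" "lin_indpt U" using U(2) by (auto simp: maximal_def)
  ultimately have "basis U" using sub U(1) dim_is_n by (intro dim_li_is_basis) auto
  then have "carrier_vec n \<subseteq> span (set (cols F))"
    using U'(1) span_is_monotone[of U "set (cols F)"] by (auto simp: basis_def)
  then have "unit_vec n t \<in> col_space F" by (auto simp: col_space_def)
  then obtain y where y: "y \<in> carrier_vec nc" "F *\<^sub>v y = unit_vec n t"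
    using col_space_eq[OF F] F by auto
  have "vec n c \<bullet> (F *\<^sub>v y) = c t" using y(2) t by simp
  moreover have "vec n c \<bullet> (F *\<^sub>v y) = (F\<^sup>T *\<^sub>v vec n c) \<bullet> y"
    using transpose_vec_mult_scalar[OF F y(1), of "vec n c"] by simp
  moreover have "F\<^sup>T *\<^sub>v vec n c = 0\<^sub>v nc"
  proof (rule eq_vecI)
    fix j assume "j < dim_vec (0\<^sub>v nc :: 'a vec)"
    then show "(F\<^sup>T *\<^sub>v vec n c) $ j = 0\<^sub>v nc $ j"
      using F c[of j] by (simp add: scalar_prod_def atLeast0LessThan mult.commute)
  qed (use F in simp)
  ultimately show ?thesis using y(1) by simp
qed

section \<open>Lexicographic order and the pivot of a single matrix\<close>

abbreviation lexless :: "((nat \<times> nat) \<times> (nat \<times> nat)) set" where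
  "lexless \<equiv> less_than <*lex*> less_than"

lemma lex_total: "p \<noteq> q \<Longrightarrow> (p, q) \<in> lexless \<or> (q, p) \<in> lexless"
  by (cases p; cases q) auto

lemma lexless_irrefl: "(p, p) \<notin> lexless"
  by (cases p) auto

lemma lexless_trans: "(p, q) \<in> lexless \<Longrightarrow> (q, r) \<in> lexless \<Longrightarrow> (p, r) \<in> lexless"
  by (cases p; cases q; cases r) auto

lemma lex_minimum:
  assumes "S \<noteq> {}"
  obtains p where "p \<in> S" "\<And>q. q \<in> S \<Longrightarrow> q \<noteq> p \<Longrightarrow> (p, q) \<in> lexless"
proof -
  have "wf lexless" by auto
  then obtain p where "p \<in> S" "\<And>q. (q, p) \<in> lexless \<Longrightarrow> q \<notin> S"
    using assms by (metis wfE_min ex_in_conv)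
  then show thesis using lex_total that by metis
qed

lemma pivot_eqI:
  assumes "p \<in> nonzero_entries A" "\<And>q. q \<in> nonzero_entries A \<Longrightarrow> q \<noteq> p \<Longrightarrow> (p, q) \<in> lexless"
  shows "pivot A = p"
  unfolding pivot_def
proof (rule the_equality)
  fix r assume r: "r \<in> nonzero_entries A \<and> (\<forall>q\<in>nonzero_entries A. q \<noteq> r \<longrightarrow> (r, q) \<in> lexless)"
  show "r = p"
  proof (rule ccontr)
    assume "r \<noteq> p"
    then have "(r, p) \<in> lexless" "(p, r) \<in> lexless" using r assms by auto
    then show False by (cases p; cases r) auto
  qed
qed (use assms in auto)

lemma
  assumes A: "A \<in> carrier_mat m1 m2" and "A \<noteq> 0\<^sub>m m1 m2"
  shows pivot_in_nonzero_entries: "pivot A \<in> nonzero_entries A"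
    and pivot_less: "\<And>q. q \<in> nonzero_entries A \<Longrightarrow> q \<noteq> pivot A \<Longrightarrow> (pivot A, q) \<in> lexless"
proof -
  have "nonzero_entries A \<noteq> {}"
    using assms by (auto simp: nonzero_entries_def)
  then obtain p where p: "p \<in> nonzero_entries A"
    "\<And>q. q \<in> nonzero_entries A \<Longrightarrow> q \<noteq> p \<Longrightarrow> (p, q) \<in> lexless" using lex_minimum by metis
  then have "pivot A = p" by (intro pivot_eqI)
  with p show "pivot A \<in> nonzero_entries A"
    "\<And>q. q \<in> nonzero_entries A \<Longrightarrow> q \<noteq> pivot A \<Longrightarrow> (pivot A, q) \<in> lexless" by auto
qed

lemma zero_before_pivot:
  assumes "A \<in> carrier_mat m1 m2" "A \<noteq> 0\<^sub>m m1 m2" "(q, pivot A) \<in> lexless" "fst q < m1" "snd q < m2"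
  shows "A $$ q = 0"
proof (rule ccontr)
  assume "A $$ q \<noteq> 0"
  then have "q \<in> nonzero_entries A" using assms by (cases q) (auto simp: nonzero_entries_def)
  moreover have "q \<noteq> pivot A" using assms(3) lexless_irrefl by metis
  ultimately have "(pivot A, q) \<in> lexless" using pivot_less assms by blast
  then show False using assms(3) by (cases q; cases "pivot A") auto
qed

lemma
  assumes "A \<in> carrier_mat m1 m2" "A \<noteq> 0\<^sub>m m1 m2"
  shows pivot_in_range: "pivot A \<in> {..<m1} \<times> {..<m2}"
    and pivot_entry_nonzero: "A $$ pivot A \<noteq> 0"
  using pivot_in_nonzero_entries[OF assms] assms(1) by (auto simp: nonzero_entries_def)

section \<open>The pivot set of a subspace\<close>

lemma submodule_matD:
  fixes \<A> :: "'a::field mat set"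
  assumes sub: "submodule class_ring \<A> (module_mat TYPE('a) m1 m2)"
  shows "\<A> \<subseteq> carrier_mat m1 m2"
    and "X \<in> \<A> \<Longrightarrow> Y \<in> \<A> \<Longrightarrow> X + Y \<in> \<A>"
    and "X \<in> \<A> \<Longrightarrow> c \<cdot>\<^sub>m X \<in> \<A>"
  using LinearCombinations.submodule.subset[OF sub] LinearCombinations.submodule.m_closed[OF sub]
    LinearCombinations.submodule.smult_closed[OF sub]
  by (simp_all add: module_mat_simps)

lemma vectorspace_submodule:
  fixes \<A> :: "'a::field mat set"
  assumes sub: "submodule class_ring \<A> (module_mat TYPE('a) m1 m2)"
  shows "vectorspace class_ring ((module_mat TYPE('a) m1 m2)\<lparr>carrier := \<A>\<rparr>)"
  by (rule vectorspace.subspace_is_vs[OF matrix_vs VectorSpace.subspace.intro[OF matrix_vs sub]])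

text \<open>In a combination of matrices with distinct pivots, the smallest pivot carrying a nonzero
  coefficient cannot be cancelled, since all other terms vanish there. The right-hand side does not
  mention \<open>B\<close>, which gives independence of the basis.\<close>

lemma pivot_basis_image:
  fixes \<A> :: "'a::field mat set"
  assumes sub: "submodule class_ring \<A> (module_mat TYPE('a) m1 m2)"
    and B: "pivot_basis m1 m2 \<A> B"
  shows "pivot ` B = pivot ` (\<A> - {0\<^sub>m m1 m2})"
proof
  let ?W = "(module_mat TYPE('a) m1 m2)\<lparr>carrier := \<A>\<rparr>"
  interpret W: vectorspace class_ring ?W by (rule vectorspace_submodule[OF sub])
  have \<A>: "\<A> \<subseteq> carrier_mat m1 m2" by (rule submodule_matD(1)[OF sub])
  have li: "W.lin_indpt B" and span: "W.span B = \<A>" and B\<A>: "B \<subseteq> \<A>" and inj: "inj_on pivot B"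
    using B unfolding pivot_basis_def W.basis_def by auto
  \<comment> \<open>The value of \<open>pivot\<close> at the zero matrix is unspecified; linear
    independence keeps that matrix out of \<open>B\<close>.\<close>
  have nz: "0\<^sub>m m1 m2 \<notin> B"
  proof -
    have "(UNIV :: 'a set) \<noteq> {0}" by (metis UNIV_I singletonD zero_neq_one)
    then show ?thesis using W.zero_nin_lin_indpt[of B] li B\<A> by (auto simp: module_mat_simps)
  qed
  show "pivot ` B \<subseteq> pivot ` (\<A> - {0\<^sub>m m1 m2})" using B\<A> nz by auto
  have smult: "c \<odot>\<^bsub>module_mat TYPE('a) m1 m2\<^esub> x \<in> \<A>" if "x \<in> \<A>" for c x
    using submodule_matD(3)[OF sub that] by (simp add: module_mat_simps)
  have entry: "W.lincomb a B' $$ q = (\<Sum>b\<in>B'. a b * b $$ q)"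
    if "finite B'" "B' \<subseteq> \<A>" "fst q < m1" "snd q < m2" for a B' q
    using that(1,2)
  proof (induction B' rule: finite_induct)
    case empty
    then show ?case using that by (cases q) (simp add: W.lincomb_def module_mat_simps)
  next
    case (insert b B')
    have "W.lincomb a (insert b B') = a b \<odot>\<^bsub>?W\<^esub> b \<oplus>\<^bsub>?W\<^esub> W.lincomb a B'"
      using insert smult unfolding W.lincomb_def by (subst W.finsum_insert) auto
    moreover have "W.lincomb a B' \<in> carrier ?W"
      using insert by (intro W.lincomb_closed) auto
    then have "W.lincomb a B' \<in> carrier_mat m1 m2" "b \<in> carrier_mat m1 m2"
      using \<A> insert.prems by auto
    ultimately show ?case using insert that(3,4) by (cases q) (auto simp: module_mat_simps)
  qed
  show "pivot ` (\<A> - {0\<^sub>m m1 m2}) \<subseteq> pivot ` B"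
  proof
    fix r assume "r \<in> pivot ` (\<A> - {0\<^sub>m m1 m2})"
    then obtain X where X: "X \<in> \<A>" "X \<noteq> 0\<^sub>m m1 m2" "r = pivot X" by auto
    have "X \<in> W.span B" using X(1) span by simp
    then obtain a B' where B': "finite B'" "B' \<subseteq> B" "X = W.lincomb a B'"
      by (auto simp: W.span_def)
    have Xc: "X \<in> carrier_mat m1 m2" using X \<A> by auto
    have Xq: "X $$ q = (\<Sum>b\<in>B'. a b * b $$ q)" if "fst q < m1" "snd q < m2" for q
      unfolding B'(3) using B' B\<A> that by (intro entry) auto
    \<comment> \<open>Terms with zero coefficient are discarded; among the others, the one with the
      smallest pivot determines the pivot of \<open>X\<close>.\<close>
    define B'' where "B'' = {b \<in> B'. a b \<noteq> 0}"
    have "B'' \<noteq> {}"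
    proof
      assume "B'' = {}"
      then have "X $$ pivot X = 0"
        using Xq[of "pivot X"] pivot_in_range[OF Xc X(2)] by (auto simp: B''_def)
      then show False using pivot_entry_nonzero[OF Xc X(2)] by simp
    qed
    then have "pivot ` B'' \<noteq> {}" by simp
    then obtain p where p: "p \<in> pivot ` B''"
      and "\<And>q. q \<in> pivot ` B'' \<Longrightarrow> q \<noteq> p \<Longrightarrow> (p, q) \<in> lexless"
      by (rule lex_minimum) (rule that)
    moreover from p obtain b where b: "b \<in> B''" "p = pivot b" by auto
    ultimately have min: "\<And>q. q \<in> pivot ` B'' \<Longrightarrow> q \<noteq> pivot b \<Longrightarrow> (pivot b, q) \<in> lexless"
      by simp
    note b = b(1)
    have B''B: "B'' \<subseteq> B" using B' by (auto simp: B''_def)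
    have carr: "b' \<in> carrier_mat m1 m2" "b' \<noteq> 0\<^sub>m m1 m2" if "b' \<in> B''" for b'
      using that B''B B\<A> \<A> nz by auto
    have br: "fst (pivot b) < m1" "snd (pivot b) < m2"
      using pivot_in_range[OF carr[OF b]] by auto
    have "pivot X = pivot b"
    proof (rule pivot_eqI)
      \<comment> \<open>Injectivity of \<open>pivot\<close> on \<open>B\<close> makes the pivots of
        the other terms strictly later, so only the term of \<open>b\<close> survives at
        \<open>pivot b\<close>.\<close>
      have "X $$ pivot b = (\<Sum>b'\<in>{b}. a b' * b' $$ pivot b)"
        unfolding Xq[OF br]
      proof (rule sum.mono_neutral_right)
        show "\<forall>b'\<in>B' - {b}. a b' * b' $$ pivot b = 0"
        proof
          fix b' assume b': "b' \<in> B' - {b}"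
          show "a b' * b' $$ pivot b = 0"
          proof (cases "a b' = 0")
            case False
            then have b'': "b' \<in> B''" using b' by (auto simp: B''_def)
            moreover have "pivot b' \<noteq> pivot b"
              using inj_onD[OF inj, of b' b] b' b b'' B''B by blast
            ultimately have "(pivot b, pivot b') \<in> lexless" using min[of "pivot b'"] by blast
            then show ?thesis using zero_before_pivot[OF carr[OF b'']] br by auto
          qed simp
        qed
      qed (use B' b in \<open>auto simp: B''_def\<close>)
      then have "X $$ pivot b \<noteq> 0"
        using b pivot_entry_nonzero[OF carr[OF b]] by (auto simp: B''_def)
      then show "pivot b \<in> nonzero_entries X"
        using br Xc by (cases "pivot b") (auto simp: nonzero_entries_def)
    next
      fix q assume q: "q \<in> nonzero_entries X" "q \<noteq> pivot b"
      have qr: "fst q < m1" "snd q < m2" "X $$ q \<noteq> 0"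
        using q Xc by (auto simp: nonzero_entries_def)
      show "(pivot b, q) \<in> lexless"
      proof (rule ccontr)
        assume "(pivot b, q) \<notin> lexless"
        then have qb: "(q, pivot b) \<in> lexless" using lex_total q by blast
        \<comment> \<open>Every pivot in \<open>B''\<close> is \<open>pivot b\<close> or later,
          hence later than \<open>q\<close>, so each term vanishes at \<open>q\<close>.\<close>
        have "a b' * b' $$ q = 0" if "b' \<in> B'" for b'
        proof (cases "a b' = 0")
          case False
          then have b'': "b' \<in> B''" using that by (auto simp: B''_def)
          then have "pivot b' = pivot b \<or> (pivot b, pivot b') \<in> lexless"
            using min[of "pivot b'"] by blast
          then have "(q, pivot b') \<in> lexless" using qb lexless_trans by metis
          then show ?thesis using zero_before_pivot[OF carr[OF b'']] qr by auto
        qed simp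
        then show False using Xq[OF qr(1,2)] qr(3) by simp
      qed
    qed
    then show "r \<in> pivot ` B" using X b B''B by auto
  qed
qed

text \<open>One matrix is chosen for each pivot that occurs in \<open>\<A>\<close>. Independence
  comes from the triangular lemma with evaluation at the pivots as functionals, spanning from
  Gaussian elimination.\<close>

lemma pivot_basis_exists:
  fixes \<A> :: "'a::field mat set"
  assumes sub: "submodule class_ring \<A> (module_mat TYPE('a) m1 m2)"
  shows "\<exists>B. pivot_basis m1 m2 \<A> B"
proof -
  let ?W = "(module_mat TYPE('a) m1 m2)\<lparr>carrier := \<A>\<rparr>"
  interpret W: vectorspace class_ring ?W by (rule vectorspace_submodule[OF sub])
  have \<A>: "\<A> \<subseteq> carrier_mat m1 m2" by (rule submodule_matD(1)[OF sub])
  have closed: "X + Y \<in> \<A>" "c \<cdot>\<^sub>m X \<in> \<A>" if "X \<in> \<A>" "Y \<in> \<A>" for X Y c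
    using submodule_matD(2,3)[OF sub] that by blast+
  define P where "P = pivot ` (\<A> - {0\<^sub>m m1 m2})"
  have range: "P \<subseteq> {..<m1} \<times> {..<m2}"
    unfolding P_def using \<A> by (intro image_subsetI pivot_in_range) auto
  then have fin: "finite P" using finite_subset by blast
  have "\<forall>p\<in>P. \<exists>X. X \<in> \<A> - {0\<^sub>m m1 m2} \<and> pivot X = p" by (auto simp: P_def)
  then obtain v where v: "\<And>p. p \<in> P \<Longrightarrow> v p \<in> \<A> - {0\<^sub>m m1 m2}" "\<And>p. p \<in> P \<Longrightarrow> pivot (v p) = p"
    by metis
  have vc: "v p \<in> carrier_mat m1 m2" "v p \<noteq> 0\<^sub>m m1 m2" if "p \<in> P" for p
    using v(1)[OF that] \<A> by auto
  have v\<A>: "v ` P \<subseteq> carrier ?W" using v by auto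
  have li: "W.lin_indpt (v ` P)"
  proof (rule lin_indpt_if_triangular(2)[where \<phi> = "\<lambda>p X. X $$ p"])
    fix S' assume S': "S' \<subseteq> P" "S' \<noteq> {}"
    \<comment> \<open>The smallest position is the right choice: a matrix whose pivot is later
      vanishes there.\<close>
    obtain p where p: "p \<in> S'" "\<And>q. q \<in> S' \<Longrightarrow> q \<noteq> p \<Longrightarrow> (p, q) \<in> lexless"
      using lex_minimum[OF S'(2)] by metis
    show "\<exists>p\<in>S'. v p $$ p \<noteq> 0 \<and> (\<forall>q\<in>S' - {p}. v q $$ p = 0)"
    proof (intro bexI[OF _ p(1)] conjI ballI)
      show "v p $$ p \<noteq> 0" using pivot_entry_nonzero[OF vc] v(2) p S' by (metis subsetD)
    next
      fix q assume q: "q \<in> S' - {p}"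
      have "fst p < m1" "snd p < m2" using p(1) S' range by auto
      then show "v q $$ p = 0"
        using zero_before_pivot[OF vc[of q], of p] v(2)[of q] p q S' by auto
    qed
  qed (use fin v\<A> \<A> range W.module_axioms in \<open>auto simp: module_mat_simps subset_iff\<close>)
  have inj: "inj_on pivot (v ` P)" using v(2) by (intro inj_onI) auto
  have zero_span: "0\<^sub>m m1 m2 \<in> W.span (v ` P)"
    using W.span_zero by (simp add: module_mat_simps)
  have span_closed: "X + c \<cdot>\<^sub>m Y \<in> W.span (v ` P)"
    if "X \<in> W.span (v ` P)" "Y \<in> W.span (v ` P)" for X Y c
    using LinearCombinations.submodule.m_closed[OF W.span_is_submodule[OF v\<A>] that(1)
        LinearCombinations.submodule.smult_closed[OF W.span_is_submodule[OF v\<A>] _ that(2)]]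
    by (simp add: module_mat_simps)
  \<comment> \<open>Elimination moves the pivot of a nonzero remainder strictly later, so the number
    of positions of \<open>P\<close> after that pivot decreases.\<close>
  have "X \<in> \<A> \<Longrightarrow> X \<in> W.span (v ` P)" for X
  proof (induction "card {q \<in> P. (pivot X, q) \<in> lexless}" arbitrary: X rule: less_induct)
    case less
    show ?case
    proof (cases "X = 0\<^sub>m m1 m2")
      case True
      then show ?thesis using zero_span by simp
    next
      case False
      define p where "p = pivot X"
      have p: "p \<in> P" using less.prems False by (auto simp: P_def p_def)
      have pr: "fst p < m1" "snd p < m2" using p range by auto
      have Xc: "X \<in> carrier_mat m1 m2" using less.prems \<A> by auto
      have vp: "v p $$ p \<noteq> 0" using pivot_entry_nonzero[OF vc[OF p]] v(2)[OF p] by simp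
      \<comment> \<open>This multiple cancels the entry of \<open>X\<close> at \<open>p\<close>.
        Before \<open>p\<close> both matrices are zero, so no earlier entry of \<open>Y\<close> can
        become nonzero.\<close>
      define c where "c = X $$ p / v p $$ p"
      define Y where "Y = X + (- c) \<cdot>\<^sub>m v p"
      have Y: "Y \<in> \<A>" unfolding Y_def using closed less.prems v(1)[OF p] by auto
      have Yq: "Y $$ q = X $$ q - c * v p $$ q" if "fst q < m1" "snd q < m2" for q
        using that Xc vc[OF p] by (cases q) (auto simp: Y_def)
      have "Y \<in> W.span (v ` P)"
      proof (cases "Y = 0\<^sub>m m1 m2")
        case True
        then show ?thesis using zero_span by simp
      next
        case YF: False
        have Yc: "Y \<in> carrier_mat m1 m2" using Y \<A> by auto
        have r: "fst (pivot Y) < m1" "snd (pivot Y) < m2" using pivot_in_range[OF Yc YF] by auto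
        have ne: "X $$ pivot Y - c * v p $$ pivot Y \<noteq> 0"
          using pivot_entry_nonzero[OF Yc YF] Yq[OF r] by simp
        have "pivot Y \<noteq> p" using ne vp by (auto simp: c_def)
        moreover have "(pivot Y, p) \<notin> lexless"
          using ne zero_before_pivot[OF Xc False _ r] zero_before_pivot[OF vc[OF p] _ r] v(2)[OF p]
          by (auto simp: p_def)
        ultimately have pY: "(p, pivot Y) \<in> lexless" using lex_total by blast
        have "{q \<in> P. (pivot Y, q) \<in> lexless} \<subset> {q \<in> P. (pivot X, q) \<in> lexless}"
        proof
          show "{q \<in> P. (pivot Y, q) \<in> lexless} \<subseteq> {q \<in> P. (pivot X, q) \<in> lexless}"
            using pY by (cases p; cases "pivot Y") (auto simp: p_def[symmetric])
          \<comment> \<open>The inclusion is strict because \<open>pivot Y\<close> is counted for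
            \<open>X\<close> but not for \<open>Y\<close>.\<close>
          have "pivot Y \<in> P" using Y YF by (auto simp: P_def)
          then show "{q \<in> P. (pivot Y, q) \<in> lexless} \<noteq> {q \<in> P. (pivot X, q) \<in> lexless}"
            using pY lexless_irrefl[of "pivot Y"] by (auto simp only: p_def[symmetric])
        qed
        then show ?thesis using less.hyps Y fin by (simp add: psubset_card_mono)
      qed
      moreover have "v p \<in> W.span (v ` P)" using W.in_own_span[OF v\<A>] p by auto
      moreover have "X = Y + c \<cdot>\<^sub>m v p"
        using Xc vc[OF p] by (intro eq_matI) (auto simp: Y_def)
      ultimately show ?thesis using span_closed by metis
    qed
  qed
  then have "W.span (v ` P) = \<A>" using W.span_is_subset2[OF v\<A>] by auto
  then have "W.basis (v ` P)" using li v\<A> unfolding W.basis_def by auto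
  then show ?thesis using inj by (auto simp: pivot_basis_def)
qed

text \<open>A basis with distinct pivots exists, and every such basis yields this one set, so the
  definite description in \<open>pivot_set\<close> denotes it. From here on bases can be left
  behind.\<close>

lemma pivot_set_eq:
  fixes \<A> :: "'a::field mat set"
  assumes sub: "submodule class_ring \<A> (module_mat TYPE('a) m1 m2)"
  shows "pivot_set m1 m2 \<A> = pivot ` (\<A> - {0\<^sub>m m1 m2})"
  unfolding pivot_set_def
  using pivot_basis_exists[OF sub] pivot_basis_image[OF sub] by (intro the_equality) blast+

section \<open>Counting positions: upper bound from a cover, lower bound from linear
  conditions\<close>

text \<open>The covering rows and columns exhaust \<open>P\<close>; a position lying in both is
  counted twice, which is harmless for an upper bound.\<close>

lemma card_le_row_column_cover:
  fixes P :: "('a \<times> 'b) set"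
  assumes fin: "finite P" "finite S\<^sub>1" "finite S\<^sub>2"
    and cover: "\<And>a b. (a, b) \<in> P \<Longrightarrow> a \<in> S\<^sub>1 \<or> b \<in> S\<^sub>2"
    and row: "\<And>a. a \<in> S\<^sub>1 \<Longrightarrow> card {b. (a, b) \<in> P} \<le> q"
    and col: "\<And>b. b \<in> S\<^sub>2 \<Longrightarrow> card {a. (a, b) \<in> P} \<le> q"
  shows "card P \<le> (card S\<^sub>1 + card S\<^sub>2) * q"
proof -
  let ?R = "\<Union>a\<in>S\<^sub>1. Pair a ` {b. (a, b) \<in> P}" and ?C = "\<Union>b\<in>S\<^sub>2. (\<lambda>a. (a, b)) ` {a. (a, b) \<in> P}"
  have sub: "P \<subseteq> ?R \<union> ?C" by (rule subrelI) (use cover in fastforce)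
  have sup: "?R \<union> ?C \<subseteq> P" by auto
  have "card P \<le> card (?R \<union> ?C)" using sub finite_subset[OF sup fin(1)] by (intro card_mono)
  also have "\<dots> \<le> card ?R + card ?C" by (rule card_Un_le)
  also have "card ?R \<le> (\<Sum>a\<in>S\<^sub>1. card (Pair a ` {b. (a, b) \<in> P}))" using fin by (intro card_UN_le)
  also have "\<dots> \<le> (\<Sum>a\<in>S\<^sub>1. q)" using row by (intro sum_mono) (simp add: card_image inj_on_def)
  also have "card ?C \<le> (\<Sum>b\<in>S\<^sub>2. card ((\<lambda>a. (a, b)) ` {a. (a, b) \<in> P}))" using fin by (intro card_UN_le)
  also have "\<dots> \<le> (\<Sum>b\<in>S\<^sub>2. q)" using col by (intro sum_mono) (simp add: card_image inj_on_def)
  finally show ?thesis by (simp add: algebra_simps)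
qed

text \<open>Vanishing at all positions of \<open>P\<close> imposes \<open>card P\<close> linear
  conditions on \<open>N\<close> coefficients. With fewer conditions than unknowns some nonzero
  coefficient vector satisfies them all; its matrix is nonzero by \<open>indep\<close>, yet vanishes
  at its own pivot.\<close>

lemma card_pivots_ge:
  fixes f :: "nat \<Rightarrow> nat \<Rightarrow> nat \<Rightarrow> 'a::field" and m1 m2 N :: nat
  defines "A \<equiv> \<lambda>c. mat m1 m2 (\<lambda>(a, b). \<Sum>t<N. c t * f a b t)"
  assumes indep: "\<And>c t. A c = 0\<^sub>m m1 m2 \<Longrightarrow> t < N \<Longrightarrow> c t = 0"
    and fin: "finite P" and P: "\<And>c. A c \<noteq> 0\<^sub>m m1 m2 \<Longrightarrow> pivot (A c) \<in> P"
  shows "N \<le> card P"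
proof (rule ccontr)
  assume "\<not> N \<le> card P"
  then have less: "card P < N" by simp
  obtain ps where ps: "set ps = P" "length ps = card P"
    using fin by (metis distinct_card finite_distinct_list)
  \<comment> \<open>The matrix of the conditions, padded with zero rows to a square so that
    determinants apply. Row \<open>card P\<close> is one of the zero rows, and the corresponding
    unit vector shows that the transpose is singular.\<close>
  define H where "H = mat N N (\<lambda>(r, t). if r < card P then f (fst (ps ! r)) (snd (ps ! r)) t else 0)"
  have H: "H \<in> carrier_mat N N" by (simp add: H_def)
  have "H\<^sup>T *\<^sub>v unit_vec N (card P) = 0\<^sub>v N"
    using less by (intro eq_vecI) (auto simp: H_def)
  then have "det H\<^sup>T = 0"
    using H less by (subst det_0_iff_vec_prod_zero_field[of _ N]) (auto intro!: exI[of _ "unit_vec N (card P)"])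
  then have "det H = 0" using det_transpose[OF H] by simp
  then obtain x where x: "x \<in> carrier_vec N" "x \<noteq> 0\<^sub>v N" "H *\<^sub>v x = 0\<^sub>v N"
    using det_0_iff_vec_prod_zero_field[OF H] by blast
  have nz: "A (($) x) \<noteq> 0\<^sub>m m1 m2"
  proof
    assume "A (($) x) = 0\<^sub>m m1 m2"
    then have "x = 0\<^sub>v N" using x indep[of "($) x"] by (intro eq_vecI) auto
    then show False using x by simp
  qed
  have carr: "A (($) x) \<in> carrier_mat m1 m2" by (simp add: A_def)
  obtain r where r: "r < card P" "ps ! r = pivot (A (($) x))"
    using P[OF nz] ps by (metis in_set_conv_nth)
  have "A (($) x) $$ (ps ! r) = (\<Sum>t<N. x $ t * f (fst (ps ! r)) (snd (ps ! r)) t)"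
    using pivot_in_range[OF carr nz] r(2) by (cases "ps ! r") (auto simp: A_def)
  also have "\<dots> = (H *\<^sub>v x) $ r"
    using x(1) r(1) less by (simp add: H_def scalar_prod_def atLeast0LessThan mult.commute)
  also have "\<dots> = 0" using x r less by simp
  finally show False using pivot_entry_nonzero[OF carr nz] r by simp
qed

section \<open>The slice space and its pivots\<close>

text \<open>An explicit parametrization of the slice space by coefficient functions, of which only
  the values below \<open>n (third_leg i j)\<close> matter.\<close>

definition slice_comb :: "(nat \<Rightarrow> nat) \<Rightarrow> 'a::field tensor3 \<Rightarrow> nat \<Rightarrow> nat \<Rightarrow> (nat \<Rightarrow> 'a) \<Rightarrow> 'a mat" where
  "slice_comb n T i j c =
     mat (n i) (n j) (\<lambda>(a, b). \<Sum>t<n (third_leg i j). c t * coeff_at T i j a b t)"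

lemma slice_carrier: "slice n T i j t \<in> carrier_mat (n i) (n j)"
  by (simp add: slice_def)

lemma slice_comb_carrier: "slice_comb n T i j c \<in> carrier_mat (n i) (n j)"
  by (simp add: slice_comb_def)

text \<open>The range is a submodule containing the slices, hence contains their span; conversely,
  the sums are built up inside the span.\<close>

lemma slice_space_eq:
  fixes T :: "'a::field tensor3"
  shows "slice_space n T i j = range (slice_comb n T i j)" (is "_ = ?R")
proof
  let ?M = "module_mat TYPE('a) (n i) (n j)"
  let ?l = "third_leg i j"
  let ?S = "{slice n T i j t | t. t < n ?l}"
  interpret V: vectorspace class_ring ?M by (rule matrix_vs)
  have S: "?S \<subseteq> carrier ?M" by (auto simp: slice_def module_mat_simps)
  have sub: "submodule class_ring ?R ?M"
  proof (unfold_locales)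
    show "?R \<subseteq> carrier ?M" by (auto simp: slice_comb_def module_mat_simps)
    show "\<zero>\<^bsub>?M\<^esub> \<in> ?R"
      by (intro range_eqI[of _ _ "\<lambda>_. 0"]) (auto simp: slice_comb_def module_mat_simps)
    fix X Y assume "X \<in> ?R" "Y \<in> ?R"
    then obtain c d where "X = slice_comb n T i j c" "Y = slice_comb n T i j d" by auto
    then show "X \<oplus>\<^bsub>?M\<^esub> Y \<in> ?R"
      by (intro range_eqI[of _ _ "\<lambda>t. c t + d t"])
        (auto simp: slice_comb_def module_mat_simps sum.distrib algebra_simps intro!: eq_matI)
  next
    fix r X assume "X \<in> ?R"
    then obtain c where "X = slice_comb n T i j c" by auto
    then show "r \<odot>\<^bsub>?M\<^esub> X \<in> ?R"
      by (intro range_eqI[of _ _ "\<lambda>t. r * c t"])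
        (auto simp: slice_comb_def module_mat_simps sum_distrib_left mult.assoc intro!: eq_matI)
  qed
  have "?S \<subseteq> ?R"
  proof
    fix X assume "X \<in> ?S"
    then obtain t where t: "t < n ?l" "X = slice n T i j t" by auto
    have "X = slice_comb n T i j (\<lambda>s. if s = t then 1 else 0)"
      using t by (auto simp: slice_comb_def slice_def if_distrib[of "\<lambda>x. x * _"] cong: if_cong intro!: eq_matI)
    then show "X \<in> ?R" by auto
  qed
  then show "slice_space n T i j \<subseteq> ?R"
    unfolding slice_space_def by (rule V.span_is_subset[OF _ sub])
  show "?R \<subseteq> slice_space n T i j"
  proof
    fix X assume "X \<in> ?R"
    then obtain c where c: "X = slice_comb n T i j c" by auto
    \<comment> \<open>Generalised from all slices to the first \<open>N\<close> of them, so that the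
      induction can add one slice at a time.\<close>
    have "mat (n i) (n j) (\<lambda>(a, b). \<Sum>t<N. c t * coeff_at T i j a b t) \<in> V.span ?S"
      if "N \<le> n ?l" for N
      using that
    proof (induction N)
      case 0
      have "mat (n i) (n j) (\<lambda>_. 0) = (0\<^sub>m (n i) (n j) :: 'a mat)" by auto
      then show ?case using V.span_zero[of ?S] by (simp add: module_mat_simps)
    next
      case (Suc N)
      have "slice n T i j N \<in> V.span ?S" using Suc.prems by (intro subsetD[OF V.in_own_span[OF S]]) auto
      then have "mat (n i) (n j) (\<lambda>(a, b). \<Sum>t<N. c t * coeff_at T i j a b t) \<oplus>\<^bsub>?M\<^esub>
          c N \<odot>\<^bsub>?M\<^esub> slice n T i j N \<in> V.span ?S"
        using Suc.IH Suc.prems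
        by (intro LinearCombinations.submodule.m_closed[OF V.span_is_submodule[OF S]]
            LinearCombinations.submodule.smult_closed[OF V.span_is_submodule[OF S]]) auto
      also have "mat (n i) (n j) (\<lambda>(a, b). \<Sum>t<N. c t * coeff_at T i j a b t) \<oplus>\<^bsub>?M\<^esub>
          c N \<odot>\<^bsub>?M\<^esub> slice n T i j N = mat (n i) (n j) (\<lambda>(a, b). \<Sum>t<Suc N. c t * coeff_at T i j a b t)"
        by (auto simp: slice_def module_mat_simps intro!: eq_matI)
      finally show ?case .
    qed
    from this[of "n ?l"] show "X \<in> slice_space n T i j"
      by (simp add: c slice_comb_def slice_space_def)
  qed
qed

lemma slice_space_submodule:
  fixes T :: "'a::field tensor3"
  shows "submodule class_ring (slice_space n T i j) (module_mat TYPE('a) (n i) (n j))"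
proof -
  interpret V: vectorspace class_ring "module_mat TYPE('a) (n i) (n j)" by (rule matrix_vs)
  show ?thesis unfolding slice_space_def
    by (rule V.span_is_submodule) (auto simp: slice_def module_mat_simps)
qed

lemma pivot_set_slice_space:
  "pivot_set (n i) (n j) (slice_space n T i j) =
     {pivot (slice_comb n T i j c) | c. slice_comb n T i j c \<noteq> 0\<^sub>m (n i) (n j)}"
  by (subst pivot_set_eq[OF slice_space_submodule]) (auto simp: slice_space_eq)

lemma pivot_set_slice_space_subset:
  "pivot_set (n i) (n j) (slice_space n T i j) \<subseteq> {..<n i} \<times> {..<n j}"
  unfolding pivot_set_slice_space using pivot_in_range[OF slice_comb_carrier] by blast

section \<open>Changing the pair of legs, and ranks of slices\<close>

lemma third_leg_eq:
  assumes "i \<in> {1, 2, 3}" "j \<in> {1, 2, 3}" "k \<in> {1, 2, 3}" "i \<noteq> j" "i \<noteq> k" "j \<noteq> k"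
  shows "third_leg i j = k"
  unfolding third_leg_def using assms by (intro the_equality) auto

lemma other_legs_eq:
  assumes "i \<in> {1, 2, 3}" "j \<in> {1, 2, 3}" "k \<in> {1, 2, 3}" "i \<noteq> j" "i \<noteq> k" "j \<noteq> k"
  shows "other_legs i = (j, k) \<or> other_legs i = (k, j)"
  using assms by (auto simp: other_legs_def)

text \<open>\<open>coeff_at\<close> names two legs and leaves the third implicit. These equations
  identify one coefficient of \<open>T\<close> as seen from different pairs of legs, which is how
  slices in different directions and the flattening are compared.\<close>

lemma coeff_at_permute:
  assumes "i \<in> {1, 2, 3}" "j \<in> {1, 2, 3}" "k \<in> {1, 2, 3}" "i \<noteq> j" "i \<noteq> k" "j \<noteq> k"
  shows "coeff_at T j k b t a = coeff_at T i j a b t" "coeff_at T i k a t b = coeff_at T i j a b t"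
    "coeff_at T k i t a b = coeff_at T i j a b t" "coeff_at T k j t b a = coeff_at T i j a b t"
  using assms by (auto simp: coeff_at_def Let_def)

text \<open>\<open>other_legs\<close> orders the remaining legs by number, so the slice may enter
  \<open>max_slice_rank\<close> transposed relative to \<open>j\<close> and \<open>k\<close>; the
  bound is therefore demanded in both orientations.\<close>

lemma le_max_slice_rank:
  fixes T :: "'a::field tensor3"
  assumes legs: "i \<in> {1, 2, 3}" "j \<in> {1, 2, 3}" "k \<in> {1, 2, 3}" "i \<noteq> j" "i \<noteq> k" "j \<noteq> k"
    and x: "x < n i"
    and r: "r \<le> vec_space.rank (n j) (slice n T j k x)" "r \<le> vec_space.rank (n k) (slice n T j k x)\<^sup>T"
  shows "r \<le> max_slice_rank n T i"
proof -
  obtain p q where pq: "other_legs i = (p, q)" "(p, q) = (j, k) \<or> (p, q) = (k, j)"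
    using other_legs_eq[OF legs] by auto
  have third: "third_leg p q = i" using pq(2) legs by (auto intro!: third_leg_eq)
  have "(slice n T j k x)\<^sup>T = slice n T k j x"
    by (intro eq_matI) (auto simp: slice_def coeff_at_permute[OF legs])
  then have "r \<le> vec_space.rank (n p) (slice n T p q x)" using r pq(2) by auto
  also have "slice n T p q x \<in> slice_space n T p q"
  proof -
    interpret V: vectorspace class_ring "module_mat TYPE('a) (n p) (n q)" by (rule matrix_vs)
    show ?thesis unfolding slice_space_def
      by (rule subsetD[OF V.in_own_span]) (use x third in \<open>auto simp: slice_def module_mat_simps\<close>)
  qed
  then have "vec_space.rank (n p) (slice n T p q x) \<le> Max (vec_space.rank (n p) ` slice_space n T p q)"
  proof (intro Max_ge imageI)
    \<comment> \<open>\<open>Max\<close> bounds the members of a finite set only; finiteness holds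
      because no rank exceeds the number of columns.\<close>
    have "vec_space.rank (n p) ` slice_space n T p q \<subseteq> {..n q}"
      using vec_space.rank_le_nc[OF slice_comb_carrier] by (auto simp: slice_space_eq)
    then show "finite (vec_space.rank (n p) ` slice_space n T p q)" using finite_subset by blast
  qed
  finally show ?thesis by (simp add: max_slice_rank_def pq(1))
qed

section \<open>Pivots within one row or one column\<close>

text \<open>The bridge to the rank bounds: row \<open>a\<close> of a combination of slices is the
  image of its coefficient vector under the slice of leg \<open>i\<close> at \<open>a\<close>, and
  column \<open>b\<close> is its image under the slice of leg \<open>j\<close> at
  \<open>b\<close>.\<close>

lemma unit_vec_scalar_slice:
  assumes legs: "i \<in> {1, 2, 3}" "j \<in> {1, 2, 3}" "k \<in> {1, 2, 3}" "i \<noteq> j" "i \<noteq> k" "j \<noteq> k"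
    and "a < n i" "b < n j"
  shows "unit_vec (n j) b \<bullet> (slice n T j k a *\<^sub>v vec (n k) c) = slice_comb n T i j c $$ (a, b)"
    and "unit_vec (n i) a \<bullet> (slice n T i k b *\<^sub>v vec (n k) c) = slice_comb n T i j c $$ (a, b)"
proof -
  note [simp] = scalar_prod_left_unit[OF mult_mat_vec_carrier[OF slice_carrier vec_carrier]]
  show "unit_vec (n j) b \<bullet> (slice n T j k a *\<^sub>v vec (n k) c) = slice_comb n T i j c $$ (a, b)"
    and "unit_vec (n i) a \<bullet> (slice n T i k b *\<^sub>v vec (n k) c) = slice_comb n T i j c $$ (a, b)"
    using assms(7,8)
    by (simp, simp add: slice_def slice_comb_def scalar_prod_def atLeast0LessThan mult.commute
        third_leg_eq[OF legs] coeff_at_permute[OF legs])+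
qed

text \<open>Within a single row or column the lexicographic order is the order of the free index. A
  matrix with a later pivot vanishes at every earlier one, so the entries at these pivots form a
  triangular array to which \<open>card_le_rank_if_triangular_nat\<close> applies.\<close>

lemma
  fixes T :: "'a::field tensor3" and n :: "nat \<Rightarrow> nat"
  assumes legs: "i \<in> {1, 2, 3}" "j \<in> {1, 2, 3}" "k \<in> {1, 2, 3}" "i \<noteq> j" "i \<noteq> k" "j \<noteq> k"
  defines "P \<equiv> pivot_set (n i) (n j) (slice_space n T i j)"
  shows card_row_pivots_le: "a < n i \<Longrightarrow> card {b. (a, b) \<in> P} \<le> max_slice_rank n T i"
    and card_column_pivots_le: "b < n j \<Longrightarrow> card {a. (a, b) \<in> P} \<le> max_slice_rank n T j"
proof -
  have "\<forall>p\<in>P. \<exists>c. slice_comb n T i j c \<noteq> 0\<^sub>m (n i) (n j) \<and> pivot (slice_comb n T i j c) = p"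
    unfolding P_def pivot_set_slice_space by auto
  then obtain C where C: "\<And>p. p \<in> P \<Longrightarrow> slice_comb n T i j (C p) \<noteq> 0\<^sub>m (n i) (n j)"
    "\<And>p. p \<in> P \<Longrightarrow> pivot (slice_comb n T i j (C p)) = p" by metis
  have range: "P \<subseteq> {..<n i} \<times> {..<n j}" unfolding P_def by (rule pivot_set_slice_space_subset)
  have diag: "slice_comb n T i j (C p) $$ p \<noteq> 0" if "p \<in> P" for p
    using pivot_entry_nonzero[OF slice_comb_carrier C(1)[OF that]] C(2)[OF that] by simp
  have low: "slice_comb n T i j (C q) $$ p = 0" if "p \<in> P" "q \<in> P" "(p, q) \<in> lexless" for p q
    using zero_before_pivot[OF slice_comb_carrier C(1)[OF that(2)]] C(2)[OF that(2)] that range by auto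
  {
    assume a: "a < n i"
    let ?S = "{b. (a, b) \<in> P}"
    have S: "?S \<subseteq> {..<n j}" using range by auto
    then have "finite ?S" using finite_subset by blast
    \<comment> \<open>\<open>u\<close> reads off the entry in one column of row \<open>a\<close>;
      \<open>w\<close> holds the coefficients of the matrix chosen for the pivot
      \<open>(a, b)\<close>.\<close>
    note rank_ge = card_le_rank_if_triangular_nat[OF slice_carrier this, where u = "unit_vec (n j)"
        and w = "\<lambda>b. vec (n k) (C (a, b))"]
    have "card ?S \<le> vec_space.rank (n j) (slice n T j k a)"
      "card ?S \<le> vec_space.rank (n k) (slice n T j k a)\<^sup>T"
      by (rule rank_ge; use S a diag low in \<open>auto simp: unit_vec_scalar_slice(1)[OF legs] subset_iff\<close>)+
    then show "card ?S \<le> max_slice_rank n T i" using legs a by (intro le_max_slice_rank[of i j k]) auto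
  }
  {
    assume b: "b < n j"
    let ?S = "{a. (a, b) \<in> P}"
    have S: "?S \<subseteq> {..<n i}" using range by auto
    then have "finite ?S" using finite_subset by blast
    note rank_ge = card_le_rank_if_triangular_nat[OF slice_carrier this, where u = "unit_vec (n i)"
        and w = "\<lambda>a. vec (n k) (C (a, b))"]
    have "card ?S \<le> vec_space.rank (n i) (slice n T i k b)"
      "card ?S \<le> vec_space.rank (n k) (slice n T i k b)\<^sup>T"
      by (rule rank_ge; use S b diag low in \<open>auto simp: unit_vec_scalar_slice(2)[OF legs] subset_iff\<close>)+
    then show "card ?S \<le> max_slice_rank n T j" using legs b by (intro le_max_slice_rank[of j i k]) auto
  }
qed

section \<open>Conciseness and the final estimate\<close>

text \<open>Up to the arrangement of entries, the slices are the rows of the flattening along leg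
  \<open>k\<close>. A vanishing combination puts \<open>c\<close> into the left kernel of that
  flattening, which is trivial by full row rank.\<close>

lemma concise_slice_comb_eq_0:
  fixes T :: "'a::field tensor3"
  assumes conc: "concise n T"
    and legs: "i \<in> {1, 2, 3}" "j \<in> {1, 2, 3}" "k \<in> {1, 2, 3}" "i \<noteq> j" "i \<noteq> k" "j \<noteq> k"
    and zero: "slice_comb n T i j c = 0\<^sub>m (n i) (n j)" and t: "t < n k"
  shows "c t = 0"
proof -
  obtain p q where pq: "other_legs k = (p, q)" "(p, q) = (i, j) \<or> (p, q) = (j, i)"
    using other_legs_eq[of k i j] legs by auto
  let ?F = "flattening n T k"
  have comb: "(\<Sum>t<n k. c t * coeff_at T i j a b t) = 0" if "a < n i" "b < n j" for a b
    using arg_cong[OF zero, of "\<lambda>X. X $$ (a, b)"] that third_leg_eq[OF legs] by (simp add: slice_comb_def)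
  show ?thesis
  proof (rule full_row_rank_left_kernel[of ?F "n k" "n p * n q"])
    show "?F \<in> carrier_mat (n k) (n p * n q)" by (simp add: flattening_def pq(1))
    show "vec_space.rank (n k) ?F = n k" using conc legs(3) unfolding concise_def by blast
    fix col assume col: "col < n p * n q"
    \<comment> \<open>That a column exists makes \<open>n q\<close> positive, so
      \<open>col mod n q\<close> is a valid index.\<close>
    then have "n q > 0" by (cases "n q") auto
    then have "col div n q < n p" "col mod n q < n q"
      using col by (auto simp: less_mult_imp_div_less)
    then have "(\<Sum>t<n k. c t * coeff_at T k p t (col div n q) (col mod n q)) = 0"
      using pq(2) comb by (auto simp: coeff_at_permute[OF legs])
    then show "(\<Sum>t<n k. c t * ?F $$ (t, col)) = 0"
      using col by (simp add: flattening_def pq(1))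
  qed (rule t)
qed

theorem theorem5p10:
  fixes T :: "'a::field tensor3" and n :: "nat \<Rightarrow> nat" and i j k :: nat
  assumes "concise n T"
    and "i \<in> {1, 2, 3}" "j \<in> {1, 2, 3}" "k \<in> {1, 2, 3}"
    and "i \<noteq> j" "i \<noteq> k" "j \<noteq> k"
  shows "tensor_rho n T i j * max (max_slice_rank n T i) (max_slice_rank n T j) \<ge> n k"
proof -
  let ?A = "slice_space n T i j"
  define P where "P = pivot_set (n i) (n j) ?A"
  define q where "q = max (max_slice_rank n T i) (max_slice_rank n T j)"
  note legs = assms(2-)
  have range: "P \<subseteq> {..<n i} \<times> {..<n j}" unfolding P_def by (rule pivot_set_slice_space_subset)
  then have fin: "finite P" using finite_subset by blast
  let ?cover = "\<lambda>r. \<exists>S\<^sub>1 S\<^sub>2. S\<^sub>1 \<subseteq> {..<n i} \<and> S\<^sub>2 \<subseteq> {..<n j} \<and>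
     P \<subseteq> (S\<^sub>1 \<times> {..<n j}) \<union> ({..<n i} \<times> S\<^sub>2) \<and> r = card S\<^sub>1 + card S\<^sub>2"
  \<comment> \<open>All rows together form a cover, so the least value defining \<open>rho\<close>
    is attained by an actual cover.\<close>
  have "?cover (card {..<n i} + card ({} :: nat set))" using range by blast
  then have "?cover (tensor_rho n T i j)"
    unfolding tensor_rho_def rho_def P_def[symmetric] by (rule LeastI)
  then obtain S\<^sub>1 S\<^sub>2 where S: "S\<^sub>1 \<subseteq> {..<n i}" "S\<^sub>2 \<subseteq> {..<n j}"
    "P \<subseteq> (S\<^sub>1 \<times> {..<n j}) \<union> ({..<n i} \<times> S\<^sub>2)" "tensor_rho n T i j = card S\<^sub>1 + card S\<^sub>2"
    by blast
  \<comment> \<open>Here the \<open>n k\<close> unknowns are the coefficients of a combination of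
    slices, and conciseness supplies the required independence.\<close>
  have "n k \<le> card P"
  proof (rule card_pivots_ge[where f = "coeff_at T i j" and ?m1.0 = "n i" and ?m2.0 = "n j"])
    have comb: "mat (n i) (n j) (\<lambda>(a, b). \<Sum>t<n k. c t * coeff_at T i j a b t) = slice_comb n T i j c" for c
      by (simp add: slice_comb_def third_leg_eq[OF legs])
    show "c t = 0" if "mat (n i) (n j) (\<lambda>(a, b). \<Sum>t<n k. c t * coeff_at T i j a b t) = 0\<^sub>m (n i) (n j)"
      "t < n k" for c t
      using concise_slice_comb_eq_0[OF assms(1) legs] that by (simp add: comb)
    show "pivot (mat (n i) (n j) (\<lambda>(a, b). \<Sum>t<n k. c t * coeff_at T i j a b t)) \<in> P"
      if "mat (n i) (n j) (\<lambda>(a, b). \<Sum>t<n k. c t * coeff_at T i j a b t) \<noteq> 0\<^sub>m (n i) (n j)" for c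
      using that by (auto simp: comb P_def pivot_set_slice_space)
  qed (rule fin)
  also have "\<dots> \<le> (card S\<^sub>1 + card S\<^sub>2) * q"
  proof (rule card_le_row_column_cover[OF fin])
    show "finite S\<^sub>1" "finite S\<^sub>2" using S finite_subset by blast+
    show "card {b. (a, b) \<in> P} \<le> q" if "a \<in> S\<^sub>1" for a
      using card_row_pivots_le[OF legs, where n = n and T = T and a = a] S(1) that by (auto simp: P_def q_def le_max_iff_disj)
    show "card {a. (a, b) \<in> P} \<le> q" if "b \<in> S\<^sub>2" for b
      using card_column_pivots_le[OF legs, where n = n and T = T and b = b] S(2) that by (auto simp: P_def q_def le_max_iff_disj)
  qed (use S(3) in auto)
  finally show ?thesis by (simp add: S(4) q_def)
qed

end
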